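(* As $n\to\infty$, $$\log \mathrm{PL}(n)\sim\left(\frac{27\cdot\zeta(3)}{4}\right)^{1/3}\cdot n^{2/3}.$$
   Context: $\mathrm{PL}(n)$ denotes the number of plane partitions of $n$: the number of arrays $(\pi_{i,j})_{i,j\ge1}$ of nonnegative integers such that $\sum_{i,j}\pi_{i,j}=n$ and all rows and columns are non-increasing, i.e. for every $k$ the sequences $i\mapsto\pi_{i,k}$ and $i\mapsto\pi_{k,i}$ are non-increasing in $i$. $\zeta(s)=\sum_{n=1}^\infty n^{-s}$ is the zeta function, $\log$ is the natural logarithm, and $g(n)\sim h(n)$ means $g(n)/h(n)\to1$. *)

theory Defs
  imports "HOL-Analysis.Analysis" "HOL-Library.Landau_Symbols"
begin

text \<open>
  Indices start at 0 instead of 1.  The sum over all entries is the (unconditional) infinite sum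
  in the discrete space \<^typ>\<open>nat\<close>, so it exists only if almost all entries vanish.
\<close>
definition plane_partitions :: "nat \<Rightarrow> (nat \<Rightarrow> nat \<Rightarrow> nat) set" where
  "plane_partitions n =
     {p. ((\<lambda>(i, j). p i j) has_sum n) UNIV \<and>
         (\<forall>k. antimono (\<lambda>i. p i k) \<and> antimono (\<lambda>i. p k i))}"

definition PL :: "nat \<Rightarrow> nat" where
  "PL n = card (plane_partitions n)"

definition zeta :: "real \<Rightarrow> real" where
  "zeta s = (\<Sum>n. real (Suc n) powr (-s))"

text \<open>Finiteness ensures that the cardinality in \<^const>\<open>PL\<close> is a genuine count.\<close>
lemma finite_plane_partitions: "finite (plane_partitions n)"
proof -
  have *: "sum (\<lambda>(i, j). p i j) F \<le> n" if "p \<in> plane_partitions n" "finite F" for p F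
  proof (rule has_sum_mono_neutral)
    show "((\<lambda>(i, j). p i j) has_sum sum (\<lambda>(i, j). p i j) F) F"
      using that(2) by (rule has_sum_finite)
    show "((\<lambda>(i, j). p i j) has_sum n) UNIV"
      using that(1) by (simp add: plane_partitions_def)
  qed auto
  have entry: "p i j \<le> n" if "p \<in> plane_partitions n" for p i j
    using *[OF that, of "{(i, j)}"] by simp
  have rows: "i < n" if "p \<in> plane_partitions n" "p i j \<noteq> 0" for p i j
  proof -
    have ge: "1 \<le> p a j" if "a \<le> i" for a
    proof -
      have "p i j \<le> p a j"
        using \<open>p \<in> plane_partitions n\<close> that
        unfolding plane_partitions_def monotone_on_def by auto
      thus ?thesis using \<open>p i j \<noteq> 0\<close> by simp
    qed
    have "Suc i = (\<Sum>a\<le>i. 1)" by simp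
    also have "\<dots> \<le> (\<Sum>a\<le>i. p a j)" by (rule sum_mono) (simp only: ge atMost_iff)
    also have "\<dots> = sum (\<lambda>(a, b). p a b) ((\<lambda>a. (a, j)) ` {..i})"
      by (subst sum.reindex) (auto simp: inj_on_def)
    also have "\<dots> \<le> n" by (rule *) (use that in auto)
    finally show ?thesis by simp
  qed
  have cols: "j < n" if "p \<in> plane_partitions n" "p i j \<noteq> 0" for p i j
  proof -
    have ge: "1 \<le> p i b" if "b \<le> j" for b
    proof -
      have "p i j \<le> p i b"
        using \<open>p \<in> plane_partitions n\<close> that
        unfolding plane_partitions_def monotone_on_def by auto
      thus ?thesis using \<open>p i j \<noteq> 0\<close> by simp
    qed
    have "Suc j = (\<Sum>b\<le>j. 1)" by simp
    also have "\<dots> \<le> (\<Sum>b\<le>j. p i b)" by (rule sum_mono) (simp only: ge atMost_iff)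
    also have "\<dots> = sum (\<lambda>(a, b). p a b) ((\<lambda>b. (i, b)) ` {..j})"
      by (subst sum.reindex) (auto simp: inj_on_def)
    also have "\<dots> \<le> n" by (rule *) (use that in auto)
    finally show ?thesis by simp
  qed
  let ?S = "{f. \<forall>x. (x \<in> {..<n} \<times> {..<n} \<longrightarrow> f x \<in> {..n}) \<and> (x \<notin> {..<n} \<times> {..<n} \<longrightarrow> f x = (0::nat))}"
  have "finite ?S" by (rule finite_set_of_finite_funs) auto
  moreover have "case_prod ` plane_partitions n \<subseteq> ?S"
    using entry rows cols by fastforce
  ultimately have "finite (case_prod ` plane_partitions n)" by (rule finite_subset[rotated])
  moreover have "inj_on case_prod (plane_partitions n)"
    by (rule inj_onI) (metis curry_case_prod)
  ultimately show ?thesis by (rule finite_imageD)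
qed

end

theory Submission
  imports Defs "HOL-Real_Asymp.Real_Asymp"
begin

text \<open>
  Cutting a plane partition along its diagonals turns it into two chains of interlacing partitions
  that start at the same main diagonal.  The one-sided generating functions are the principal
  specialisations of Schur polynomials; a toggle on partitions squeezed between two given ones yields
  the Pieri rule, iterating it yields the Cauchy identity, and hence MacMahon's product
  $\prod_{i,j<N} (1 - x^{i+j+1})^{-1}$ for plane partitions with base in an $N \times N$ square.

  Taking logarithms, $t^2 \log \sum_n \mathrm{PL}(n) e^{-tn} \to \zeta(3)$ as $t \to 0^+$.  Since
  $\mathrm{PL}$ is increasing, an elementary Tauberian argument (Chernoff bounds at slightly shifted
  values of $t$ show that the mass of the series sits at $n \approx 2 \zeta(3) / t^3$) transfers this to
  $\log \mathrm{PL}(n)$.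
\<close>

section \<open>Interlacing partitions and the Cauchy identity\<close>

text \<open>The constant comes from minimising \<open>t * n + zeta 3 / t^2\<close> over t > 0: the
  minimum lies at t = (2 zeta(3) / n)^(1/3) and equals 3 zeta(3) / t^2 = (27 zeta(3) / 4)^(1/3)
  n^(2/3). One term of the series is at most the whole series, so the upper bound is immediate. The
  lower bound is the obstacle: the leading order of a logarithm says nothing about a single
  coefficient. Taking t slightly above the minimiser moves the mass just below n, where no
  coefficient exceeds PL(n). The infinite product never occurs. Finite boxes suffice, since their
  products bound the partial sums of the series from above and the full series from below. Sums over
  sequences are taken in [0, \<infinity>], where they may be exchanged freely.\<close>

abbreviation esum :: "('a \<Rightarrow> ennreal) \<Rightarrow> ennreal"  (binder "ESUM " 10)
  where "esum f \<equiv> nn_integral (count_space UNIV) f"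

text \<open>Tonelli for counting measures, without countability: the index types below are function
  spaces, where a sigma-finite version would not apply.\<close>

lemma esum_swap: "(ESUM x. ESUM y. f x y) = (ESUM y. ESUM x. f x y)"
  using nn_integral_fst_count_space[of "case_prod f"] nn_integral_snd_count_space[of "case_prod f"]
  by simp

lemma esum_cmult: "(ESUM x. c * f x) = c * (ESUM x. f x)"
  by (simp add: nn_integral_cmult)

text \<open>Serves in both directions: to evaluate a sum, and to introduce a summation variable for
  a quantity that couples two sums.\<close>

lemma esum_delta: "(ESUM x. of_bool (x = a) * f x) = f a"
proof -
  have "(ESUM x. of_bool (x = a) * f x) = (\<integral>\<^sup>+x. f x \<partial>count_space {a})"
    by (simp add: nn_integral_count_space_indicator indicator_def mult.commute)
  thus ?thesis by (simp add: nn_integral_count_space_finite)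
qed

lemma esum_restrict: "(ESUM x. of_bool (x \<in> A) * f x) = (\<integral>\<^sup>+x. f x \<partial>count_space A)"
  by (cases "A = UNIV")
     (simp_all add: nn_integral_count_space_indicator indicator_def mult.commute)

lemma esum_prod: "(ESUM z. f z) = (ESUM x. ESUM y. f (x, y))"
  by (rule nn_integral_fst_count_space[symmetric])

text \<open>The chain \<open>l 0 \<ge> m 0 \<ge> l 1 \<ge> m 1 \<ge> ...\<close>, that is, l/m is a
  horizontal strip. It forces both sequences to be non-increasing, so arbitrary functions can stand
  in for partitions.\<close>

definition interlace :: "(nat \<Rightarrow> nat) \<Rightarrow> (nat \<Rightarrow> nat) \<Rightarrow> bool" where
  "interlace l m \<longleftrightarrow> (\<forall>i. m i \<le> l i \<and> l (Suc i) \<le> m i)"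

definition finsupp :: "(nat \<Rightarrow> nat) \<Rightarrow> bool" where
  "finsupp l \<longleftrightarrow> (\<exists>m. \<forall>i\<ge>m. l i = 0)"

text \<open>A sum over an infinite set is 0, so the value is meaningful only under
  \<open>finsupp\<close>.\<close>

definition psize :: "(nat \<Rightarrow> nat) \<Rightarrow> nat" where
  "psize l = (\<Sum>i | l i \<noteq> 0. l i)"

lemma psize_eq:
  assumes "\<And>i. i \<ge> m \<Longrightarrow> l i = 0"
  shows "psize l = (\<Sum>i<m. l i)"
proof -
  have "{i. l i \<noteq> 0} \<subseteq> {..<m}"
    using assms by (metis (mono_tags, lifting) lessThan_iff linorder_not_less mem_Collect_eq subsetI)
  thus ?thesis unfolding psize_def by (intro sum.mono_neutral_left) auto
qed

lemma finsupp_interlace_upper: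
  assumes "interlace l m" "finsupp m"
  shows "finsupp l"
proof -
  obtain b where b: "\<forall>i\<ge>b. m i = 0" using assms(2) by (auto simp: finsupp_def)
  have "l i = 0" if i: "Suc b \<le> i" for i
  proof -
    from i obtain j where j: "i = Suc j" "b \<le> j" by (cases i) auto
    have "l (Suc j) \<le> m j" using assms(1) unfolding interlace_def by blast
    thus ?thesis using b j by simp
  qed
  thus ?thesis unfolding finsupp_def by blast
qed

lemma finsupp_interlace_lower: "interlace l m \<Longrightarrow> finsupp l \<Longrightarrow> finsupp m"
  by (auto simp: finsupp_def interlace_def) (metis le_zero_eq)

lemma psize_mono:
  assumes "interlace l m" "finsupp l"
  shows "psize m \<le> psize l"
proof -
  obtain b where b: "\<forall>i\<ge>b. l i = 0" using assms(2) by (auto simp: finsupp_def)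
  have b': "\<forall>i\<ge>b. m i = 0" using b assms(1) by (auto simp: interlace_def) (metis le_zero_eq)
  show ?thesis using b b' assms(1)
    by (subst (1 2) psize_eq[of b]) (auto intro!: sum_mono simp: interlace_def)
qed

text \<open>
  For \<open>i > 0\<close>, both the \<open>i\<close>-th part of a partition above \<open>m\<close> and \<open>n\<close> and the \<open>(i-1)\<close>-st part of one below
  them range over the same interval, which is reflected; the excess of the largest part is unconstrained.
\<close>
definition toggle :: "(nat \<Rightarrow> nat) \<Rightarrow> (nat \<Rightarrow> nat) \<Rightarrow> (nat \<Rightarrow> nat) \<Rightarrow> nat \<times> (nat \<Rightarrow> nat)" where
  "toggle m n l = (l 0 - max (m 0) (n 0),
     \<lambda>i. max (m (Suc i)) (n (Suc i)) + min (m i) (n i) - l (Suc i))"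

lemma interlace_above_iff:
  "interlace l m \<and> interlace l n \<longleftrightarrow> max (m 0) (n 0) \<le> l 0 \<and>
     (\<forall>i. max (m (Suc i)) (n (Suc i)) \<le> l (Suc i) \<and> l (Suc i) \<le> min (m i) (n i))"
proof -
  have split: "(\<forall>i. P i) \<longleftrightarrow> P 0 \<and> (\<forall>i. P (Suc i))" for P :: "nat \<Rightarrow> bool"
    by (metis not0_implies_Suc)
  show ?thesis
    unfolding interlace_def all_conj_distrib max.bounded_iff min.bounded_iff
      split[of "\<lambda>i. m i \<le> l i"] split[of "\<lambda>i. n i \<le> l i"] by blast
qed

lemma interlace_below_iff:
  "interlace m k \<and> interlace n k \<longleftrightarrow>
     (\<forall>i. max (m (Suc i)) (n (Suc i)) \<le> k i \<and> k i \<le> min (m i) (n i))"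
  unfolding interlace_def by auto

lemma bij_betw_toggle:
  "bij_betw (toggle m n) {l. interlace l m \<and> interlace l n} (UNIV \<times> {k. interlace m k \<and> interlace n k})"
  unfolding interlace_above_iff interlace_below_iff
proof (rule bij_betw_byWitness[where f' = "\<lambda>(a, k). case_nat (a + max (m 0) (n 0))
         (\<lambda>i. max (m (Suc i)) (n (Suc i)) + min (m i) (n i) - k i)"], goal_cases)
  \<comment> \<open>The inverse repeats the reflection c -> M + W - c, an involution of [M, W];
    these two facts handle the truncated subtraction.\<close>
  have *: "a + b - (a + b - c) = c" if "c \<le> b" for a b c :: nat
    using that by simp
  have **: "M \<le> M + W - c" "M + W - c \<le> W" if "M \<le> c" "c \<le> W" for M W c :: nat
    using that by auto
  case 1 show ?case
    by (auto simp: toggle_def fun_eq_iff * simp del: max.bounded_iff min.bounded_iff split: nat.splits)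
  case 2 show ?case
    by (auto simp: toggle_def fun_eq_iff * simp del: max.bounded_iff min.bounded_iff split: nat.splits)
  case 3 show ?case
    by (auto simp: toggle_def ** simp del: max.bounded_iff min.bounded_iff)
  case 4 show ?case
    by (auto simp: ** simp del: max.bounded_iff min.bounded_iff)
qed

text \<open>The reflection gives \<open>l (Suc i) + k i = M (Suc i) + W i\<close> for the maxima M
  and minima W. Summed over i, these recombine through \<open>M i + W i = m i + n i\<close>, and
  only the excess of the largest part is left over.\<close>

lemma psize_toggle:
  assumes "interlace l m" "interlace l n" "finsupp m" "finsupp n" "toggle m n l = (a, k)"
  shows "psize l + psize k = psize m + psize n + a"
proof -
  obtain b1 b2 where "\<forall>i\<ge>b1. m i = 0" "\<forall>i\<ge>b2. n i = 0"
    using assms(3,4) by (auto simp: finsupp_def)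
  then obtain b where b: "\<And>i. i \<ge> b \<Longrightarrow> m i = 0" "\<And>i. i \<ge> b \<Longrightarrow> n i = 0"
    by (metis nle_le order_trans)
  define M where "M i = max (m i) (n i)" for i
  define W where "W i = min (m i) (n i)" for i
  have int: "M 0 \<le> l 0" "\<And>i. M (Suc i) \<le> l (Suc i)" "\<And>i. l (Suc i) \<le> W i"
    using iffD1[OF interlace_above_iff conjI, OF assms(1,2)] unfolding M_def W_def by blast+
  have a: "l 0 = a + M 0" and k: "k = (\<lambda>i. M (Suc i) + W i - l (Suc i))"
    using assms(5) int(1) by (auto simp: toggle_def M_def W_def)
  have Z: "M i = 0" "W i = 0" if "i \<ge> b" for i using b that by (auto simp: M_def W_def)
  have l0: "l (Suc i) = 0" if "i \<ge> b" for i
    using int(3)[of i] Z(2)[OF that] by simp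
  have "psize l = (\<Sum>i<Suc b. l i)"
    by (rule psize_eq) (metis l0 Suc_le_D Suc_le_mono)
  also have "\<dots> = l 0 + (\<Sum>i<b. l (Suc i))" by (rule sum.lessThan_Suc_shift)
  finally have sl: "psize l = l 0 + (\<Sum>i<b. l (Suc i))" .
  have sk: "psize k = (\<Sum>i<b. k i)"
    by (rule psize_eq) (use Z in \<open>simp add: k\<close>)
  have sm: "psize m = (\<Sum>i<b. m i)" and sn: "psize n = (\<Sum>i<b. n i)"
    using b by (auto intro!: psize_eq)
  have "psize l + psize k = l 0 + (\<Sum>i<b. l (Suc i) + k i)"
    using sl sk by (simp add: sum.distrib)
  also have "(\<Sum>i<b. l (Suc i) + k i) = (\<Sum>i<b. M (Suc i) + W i)"
    by (rule sum.cong) (use int in \<open>auto simp: k trans_le_add2\<close>)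
  also have "l 0 + \<dots> = a + (M 0 + (\<Sum>i<b. M (Suc i))) + (\<Sum>i<b. W i)"
    by (simp add: a sum.distrib)
  also have "M 0 + (\<Sum>i<b. M (Suc i)) = (\<Sum>i<Suc b. M i)" by (rule sum.lessThan_Suc_shift[symmetric])
  also have "\<dots> = (\<Sum>i<b. M i)" using Z by simp
  also have "a + (\<Sum>i<b. M i) + (\<Sum>i<b. W i) = a + (\<Sum>i<b. m i + n i)"
    by (simp add: sum.distrib[symmetric] M_def W_def max_def min_def) (auto intro: sum.cong)
  finally show ?thesis by (simp add: sum.distrib sm sn)
qed

definition geom :: "ennreal \<Rightarrow> ennreal" where
  "geom x = (\<Sum>n. x ^ n)"

text \<open>The unconstrained excess of the largest part produces the geometric factor. The exponent
  is \<open>psize n - psize k\<close> because a power of \<open>y\<close> could not be cancelled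
  when \<open>y\<close> is 0 or infinite.\<close>

lemma esum_interlace_toggle:
  assumes "finsupp m" "finsupp n"
  shows "(ESUM l. of_bool (interlace l m \<and> interlace l n) * y ^ psize l) =
         geom y * (ESUM k. of_bool (interlace m k \<and> interlace n k) * (y ^ psize m * y ^ (psize n - psize k)))"
proof -
  let ?A = "{l. interlace l m \<and> interlace l n}" and ?B = "{k. interlace m k \<and> interlace n k}"
  define f where "f = (\<lambda>(a, k). y ^ a * (y ^ psize m * y ^ (psize n - psize k)))"
  have "(ESUM l. of_bool (interlace l m \<and> interlace l n) * y ^ psize l) = (\<integral>\<^sup>+l. y ^ psize l \<partial>count_space ?A)"
    using esum_restrict[of ?A "\<lambda>l. y ^ psize l"] by simp
  also have "\<dots> = (\<integral>\<^sup>+l. f (toggle m n l) \<partial>count_space ?A)"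
  proof (rule nn_integral_cong)
    fix l assume "l \<in> space (count_space ?A)"
    hence l: "interlace l m" "interlace l n" by auto
    obtain a k where t: "toggle m n l = (a, k)" by force
    from l have "toggle m n l \<in> UNIV \<times> ?B" using bij_betw_toggle[of m n] by (auto dest: bij_betwE)
    hence "psize k \<le> psize n" using t assms by (auto intro: psize_mono)
    with psize_toggle[OF l assms t] have "psize l = a + (psize m + (psize n - psize k))" by simp
    thus "y ^ psize l = f (toggle m n l)" by (simp add: t f_def power_add)
  qed
  also have "\<dots> = (\<integral>\<^sup>+z. f z \<partial>count_space (UNIV \<times> ?B))"
    by (rule nn_integral_bij_count_space[OF bij_betw_toggle])
  also have "\<dots> = (ESUM z. of_bool (z \<in> UNIV \<times> ?B) * f z)"
    by (rule esum_restrict[symmetric])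
  also have "\<dots> = (ESUM a. ESUM k. y ^ a * (of_bool (interlace m k \<and> interlace n k) * (y ^ psize m * y ^ (psize n - psize k))))"
    by (subst esum_prod) (simp add: f_def mult_ac)
  also have "\<dots> = geom y * (ESUM k. of_bool (interlace m k \<and> interlace n k) * (y ^ psize m * y ^ (psize n - psize k)))"
    by (simp add: esum_cmult nn_integral_multc nn_integral_count_space_nat geom_def)
  finally show ?thesis .
qed

text \<open>The Schur polynomial $s_l(1, q, \dots, q^{N-1})$, expanded by its branching rule.\<close>
primrec principal_schur :: "ennreal \<Rightarrow> nat \<Rightarrow> (nat \<Rightarrow> nat) \<Rightarrow> ennreal" where
  "principal_schur q 0 l = of_bool (l = (\<lambda>_. 0))"
| "principal_schur q (Suc N) l = (ESUM m. of_bool (interlace l m) * (q ^ psize m * principal_schur q N m))"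

text \<open>Lets sums range over all functions: the spurious values of \<open>psize\<close> are
  multiplied by 0.\<close>

lemma principal_schur_not_finsupp: "\<not> finsupp l \<Longrightarrow> principal_schur q N l = 0"
proof (induction N arbitrary: l)
  case (Suc N)
  have "of_bool (interlace l m) * (q ^ psize m * principal_schur q N m) = 0" for m
    using Suc finsupp_interlace_upper[of l m] by (cases "finsupp m") auto
  hence "principal_schur q (Suc N) l = (ESUM m::nat \<Rightarrow> nat. 0)"
    unfolding principal_schur.simps by (intro nn_integral_cong) auto
  thus ?case by simp
qed (auto simp: finsupp_def)

text \<open>The branching rule exposes some m below l, the toggle trades l for a k below m and n at
  the price of one geometric factor, and the remaining sum over m is the same identity for N
  variables at \<open>k\<close> and \<open>y * q\<close>. Hence both \<open>n\<close> and
  \<open>y\<close> vary in the induction.\<close>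

lemma principal_schur_pieri:
  assumes "finsupp n"
  shows "(ESUM l. of_bool (interlace l n) * (y ^ psize l * principal_schur q N l)) =
         (\<Prod>i<N. geom (y * q ^ i)) * (y ^ psize n * principal_schur q N n)"
  using assms
proof (induction N arbitrary: n y)
  case 0
  have "(ESUM l. of_bool (interlace l n) * (y ^ psize l * principal_schur q 0 l)) =
        (ESUM l. of_bool (l = (\<lambda>_. 0)) * (of_bool (interlace l n) * y ^ psize l))"
    by (intro nn_integral_cong) auto
  also have "\<dots> = of_bool (interlace (\<lambda>_. 0) n) * y ^ psize (\<lambda>_. 0)"
    by (rule esum_delta)
  also have "interlace (\<lambda>_. 0) n \<longleftrightarrow> n = (\<lambda>_. 0)" by (auto simp: interlace_def)
  finally show ?case by (auto simp: psize_def)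
next
  case (Suc N)
  let ?G = "\<lambda>i. geom (y * q ^ i)"
  have "(ESUM l. of_bool (interlace l n) * (y ^ psize l * principal_schur q (Suc N) l)) =
        (ESUM l. ESUM m. (q ^ psize m * principal_schur q N m) * (of_bool (interlace l m \<and> interlace l n) * y ^ psize l))"
    by (auto simp: esum_cmult[symmetric] mult_ac intro!: nn_integral_cong)
  also have "\<dots> = (ESUM m. ESUM l. (q ^ psize m * principal_schur q N m) * (of_bool (interlace l m \<and> interlace l n) * y ^ psize l))"
    by (rule esum_swap)
  also have "\<dots> = (ESUM m. (q ^ psize m * principal_schur q N m) * (ESUM l. of_bool (interlace l m \<and> interlace l n) * y ^ psize l))"
    by (simp only: esum_cmult)
  also have "\<dots> = (ESUM m. (q ^ psize m * principal_schur q N m) * (?G 0 *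
        (ESUM k. of_bool (interlace m k \<and> interlace n k) * (y ^ psize m * y ^ (psize n - psize k)))))"
  proof (intro nn_integral_cong)
    fix m
    show "(q ^ psize m * principal_schur q N m) * (ESUM l. of_bool (interlace l m \<and> interlace l n) * y ^ psize l) =
       (q ^ psize m * principal_schur q N m) * (?G 0 *
        (ESUM k. of_bool (interlace m k \<and> interlace n k) * (y ^ psize m * y ^ (psize n - psize k))))"
      using esum_interlace_toggle[of m n y] Suc.prems by (cases "finsupp m") (auto simp: principal_schur_not_finsupp)
  qed
  also have "\<dots> = (ESUM m. ESUM k. ?G 0 * (of_bool (interlace n k) * y ^ (psize n - psize k) *
                   (of_bool (interlace m k) * ((y * q) ^ psize m * principal_schur q N m))))"
    by (auto simp: esum_cmult[symmetric] power_mult_distrib mult_ac intro!: nn_integral_cong)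
  also have "\<dots> = (ESUM k. ESUM m. ?G 0 * (of_bool (interlace n k) * y ^ (psize n - psize k) *
                   (of_bool (interlace m k) * ((y * q) ^ psize m * principal_schur q N m))))"
    by (rule esum_swap)
  also have "\<dots> = ?G 0 * (ESUM k. of_bool (interlace n k) * y ^ (psize n - psize k) *
                   (ESUM m. of_bool (interlace m k) * ((y * q) ^ psize m * principal_schur q N m)))"
    by (simp only: esum_cmult)
  also have "\<dots> = ?G 0 * (ESUM k. ((\<Prod>i<N. ?G (Suc i)) * y ^ psize n) * (of_bool (interlace n k) * (q ^ psize k * principal_schur q N k)))"
  proof (rule arg_cong[where f = "\<lambda>x. ?G 0 * x"], rule nn_integral_cong)
    fix k
    show "of_bool (interlace n k) * y ^ (psize n - psize k) *
                   (ESUM m. of_bool (interlace m k) * ((y * q) ^ psize m * principal_schur q N m)) =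
          ((\<Prod>i<N. ?G (Suc i)) * y ^ psize n) * (of_bool (interlace n k) * (q ^ psize k * principal_schur q N k))"
    proof (cases "interlace n k")
      case True
      hence k: "finsupp k" "psize k \<le> psize n"
        using Suc.prems by (auto intro: psize_mono finsupp_interlace_lower)
      have "y ^ psize n = y ^ (psize n - psize k) * y ^ psize k"
        using k by (simp flip: power_add)
      with True Suc.IH[OF k(1), of "y * q"] show ?thesis
        by (simp add: power_mult_distrib mult_ac)
    qed auto
  qed
  also have "\<dots> = (?G 0 * (\<Prod>i<N. ?G (Suc i))) * (y ^ psize n * principal_schur q (Suc N) n)"
    by (simp only: esum_cmult principal_schur.simps) (simp only: mult_ac)
  also have "?G 0 * (\<Prod>i<N. ?G (Suc i)) = (\<Prod>i<Suc N. ?G i)"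
    by (rule prod.lessThan_Suc_shift[symmetric])
  finally show ?case .
qed

text \<open>Removing a variable from the second Schur factor leaves a sum over l to which the Pieri
  rule applies, and turns \<open>z\<close> into \<open>z * q\<close>. So \<open>z\<close> must be
  free, although only z = q is used for plane partitions.\<close>

lemma principal_schur_cauchy:
  "(ESUM l. z ^ psize l * (principal_schur q N l * principal_schur q M l)) =
     (\<Prod>j<M. \<Prod>i<N. geom (z * q ^ (i + j)))"
proof (induction M arbitrary: z)
  case 0
  have schur_zero: "principal_schur q N (\<lambda>_. 0) = 1"
  proof (induction N)
    case (Suc N)
    have "interlace (\<lambda>_. 0) m \<longleftrightarrow> m = (\<lambda>_. 0)" for m by (auto simp: interlace_def)
    thus ?case using Suc by (simp add: esum_delta psize_def)
  qed auto
  have "(ESUM l. z ^ psize l * (principal_schur q N l * principal_schur q 0 l)) = (ESUM l. of_bool (l = (\<lambda>_. 0)) * (z ^ psize l * principal_schur q N l))"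
    by (intro nn_integral_cong) auto
  thus ?case by (simp add: esum_delta schur_zero psize_def)
next
  case (Suc M)
  let ?G = "\<lambda>i. geom (z * q ^ i)"
  have "(ESUM l. z ^ psize l * (principal_schur q N l * principal_schur q (Suc M) l)) =
        (ESUM l. ESUM m. (q ^ psize m * principal_schur q M m) * (of_bool (interlace l m) * (z ^ psize l * principal_schur q N l)))"
    by (auto simp: esum_cmult[symmetric] mult_ac intro!: nn_integral_cong)
  also have "\<dots> = (ESUM m. ESUM l. (q ^ psize m * principal_schur q M m) * (of_bool (interlace l m) * (z ^ psize l * principal_schur q N l)))"
    by (rule esum_swap)
  also have "\<dots> = (ESUM m. (q ^ psize m * principal_schur q M m) * (ESUM l. of_bool (interlace l m) * (z ^ psize l * principal_schur q N l)))"
    by (simp only: esum_cmult)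
  also have "\<dots> = (ESUM m. (\<Prod>i<N. ?G i) * ((z * q) ^ psize m * (principal_schur q N m * principal_schur q M m)))"
  proof (intro nn_integral_cong)
    fix m
    show "(q ^ psize m * principal_schur q M m) * (ESUM l. of_bool (interlace l m) * (z ^ psize l * principal_schur q N l)) =
          (\<Prod>i<N. ?G i) * ((z * q) ^ psize m * (principal_schur q N m * principal_schur q M m))"
    proof (cases "finsupp m")
      case True
      show ?thesis unfolding principal_schur_pieri[OF True] by (simp add: power_mult_distrib mult_ac)
    qed (auto simp: principal_schur_not_finsupp)
  qed
  also have "\<dots> = (\<Prod>i<N. ?G i) * (\<Prod>j<M. \<Prod>i<N. geom (z * q * q ^ (i + j)))"
    by (simp only: esum_cmult Suc.IH)
  also have "\<dots> = (\<Prod>j<Suc M. \<Prod>i<N. geom (z * q ^ (i + j)))"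
    by (subst prod.lessThan_Suc_shift) (simp add: mult_ac)
  finally show ?case .
qed

section \<open>Diagonals of plane partitions\<close>

definition chain :: "nat \<Rightarrow> (nat \<Rightarrow> nat \<Rightarrow> nat) \<Rightarrow> bool" where
  "chain N d \<longleftrightarrow> (\<forall>k. interlace (d k) (d (Suc k))) \<and> (\<forall>k\<ge>N. d k = (\<lambda>_. 0))"

lemma chain_case_nat:
  "chain (Suc N) (case_nat l d) \<longleftrightarrow> interlace l (d 0) \<and> chain N d"
proof -
  have "(\<forall>k. interlace (case_nat l d k) (case_nat l d (Suc k))) \<longleftrightarrow>
        interlace l (d 0) \<and> (\<forall>k. interlace (d k) (d (Suc k)))"
    by (auto split: nat.splits)
  moreover have "(\<forall>k\<ge>Suc N. case_nat l d k = (\<lambda>_. 0)) \<longleftrightarrow> (\<forall>k\<ge>N. d k = (\<lambda>_. 0))"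
    by (auto split: nat.splits)
  ultimately show ?thesis unfolding chain_def by blast
qed

text \<open>The branching rule unrolled. The top \<open>d 0 = l\<close> carries no weight: two
  chains are glued there, and the main diagonal must be counted once.\<close>

lemma principal_schur_eq_esum_chain:
  "principal_schur q N l = (ESUM d. of_bool (d 0 = l \<and> chain N d) * q ^ (\<Sum>k<N. psize (d (Suc k))))"
proof (induction N arbitrary: l)
  case 0
  have c: "chain 0 d \<longleftrightarrow> d = (\<lambda>_ _. 0)" for d
    by (auto simp: chain_def interlace_def)
  have "(ESUM d. of_bool (d 0 = l \<and> chain 0 d) * q ^ (\<Sum>k<(0::nat). psize (d (Suc k)))) =
         (ESUM d. of_bool (d = (\<lambda>(_::nat) _. 0)) * of_bool (d 0 = l))"
    by (intro nn_integral_cong) (auto simp: c)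
  also have "\<dots> = of_bool ((\<lambda>_. 0) = l)" by (rule esum_delta)
  finally show ?case by auto
next
  case (Suc N)
  let ?w = "\<lambda>N d. q ^ (\<Sum>k<N. psize (d (Suc k)))"
  let ?A = "{d. interlace l (d 0) \<and> chain N d}" and ?B = "{e. e 0 = l \<and> chain (Suc N) e}"
  have e: "case_nat (e 0) (\<lambda>k. e (Suc k)) = e" for e :: "nat \<Rightarrow> nat \<Rightarrow> nat"
    by (auto simp: fun_eq_iff split: nat.splits)
  have bij: "bij_betw (case_nat l) ?A ?B"
  proof (rule bij_betw_byWitness[where f' = "\<lambda>e k. e (Suc k)"])
    show "(\<lambda>e k. e (Suc k)) ` ?B \<subseteq> ?A"
      using chain_case_nat[of N "e 0" "\<lambda>k. e (Suc k)" for e] by (auto simp: e)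
  qed (auto simp: chain_case_nat e)
  have "principal_schur q (Suc N) l = (ESUM m. ESUM d. of_bool (m = d 0) *
          (of_bool (interlace l m \<and> chain N d) * (q ^ psize m * ?w N d)))"
    unfolding principal_schur.simps Suc.IH esum_cmult[symmetric]
    by (intro nn_integral_cong) (auto simp: mult_ac)
  also have "\<dots> = (ESUM d. ESUM m. of_bool (m = d 0) *
          (of_bool (interlace l m \<and> chain N d) * (q ^ psize m * ?w N d)))"
    by (rule esum_swap)
  also have "\<dots> = (ESUM d. of_bool (d \<in> ?A) * ?w (Suc N) (case_nat l d))"
    by (simp add: esum_delta sum.lessThan_Suc_shift power_add del: sum.lessThan_Suc)
  also have "\<dots> = (\<integral>\<^sup>+d. ?w (Suc N) (case_nat l d) \<partial>count_space ?A)"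
    by (rule esum_restrict)
  also have "\<dots> = (\<integral>\<^sup>+e. ?w (Suc N) e \<partial>count_space ?B)"
    by (rule nn_integral_bij_count_space[OF bij])
  also have "\<dots> = (ESUM e. of_bool (e \<in> ?B) * ?w (Suc N) e)"
    by (rule esum_restrict[symmetric])
  finally show ?case by simp
qed

text \<open>By monotonicity, the last two conditions say that the support lies in \<open>{..<N} \<times> {..<N}\<close>.\<close>
definition box_partitions :: "nat \<Rightarrow> (nat \<Rightarrow> nat \<Rightarrow> nat) set" where
  "box_partitions N =
     {p. (\<forall>k. antimono (\<lambda>i. p i k) \<and> antimono (\<lambda>i. p k i)) \<and> p 0 N = 0 \<and> p N 0 = 0}"

definition box_size :: "nat \<Rightarrow> (nat \<Rightarrow> nat \<Rightarrow> nat) \<Rightarrow> nat" where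
  "box_size N p = (\<Sum>i<N. \<Sum>j<N. p i j)"

definition diagonals :: "(nat \<Rightarrow> nat \<Rightarrow> nat) \<Rightarrow> (nat \<Rightarrow> nat \<Rightarrow> nat) \<times> (nat \<Rightarrow> nat \<Rightarrow> nat)" where
  "diagonals p = ((\<lambda>k i. p i (i + k)), (\<lambda>k i. p (i + k) i))"

lemma box_partitions_antimono:
  assumes "p \<in> box_partitions N" "i \<le> i'" "j \<le> j'"
  shows "p i' j' \<le> p i j"
proof -
  have "p i' j' \<le> p i j'" "p i j' \<le> p i j"
    using assms by (auto simp: box_partitions_def antimono_def)
  thus ?thesis by simp
qed

lemma box_partitions_zero:
  assumes "p \<in> box_partitions N" "i \<ge> N \<or> j \<ge> N"
  shows "p i j = 0"
  using assms box_partitions_antimono[OF assms(1), of 0 i N j] box_partitions_antimono[OF assms(1), of N i 0 j]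
  by (auto simp: box_partitions_def)

text \<open>A step along a row or column leads to a neighbouring diagonal, so monotone rows and
  columns amount to interlacing of consecutive diagonals.\<close>

lemma bij_betw_diagonals:
  "bij_betw diagonals (box_partitions N) {(d, e). d 0 = e 0 \<and> chain N d \<and> chain N e}"
proof (rule bij_betw_byWitness[where f' = "\<lambda>(d, e) i j. if i \<le> j then d (j - i) i else e (i - j) j"], goal_cases)
  case 1 show ?case by (auto simp: diagonals_def fun_eq_iff)
next
  case 2
  show ?case by (auto simp: diagonals_def fun_eq_iff)
next
  case 3
  show ?case
    by (auto simp: diagonals_def chain_def interlace_def fun_eq_iff box_partitions_zero
             intro: box_partitions_antimono)
next
  case 4
  show ?case
  proof clarify
    fix d e :: "nat \<Rightarrow> nat \<Rightarrow> nat"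
    assume de: "d 0 = e 0" "chain N d" "chain N e"
    have d: "d (Suc k) i \<le> d k i" "d k (Suc i) \<le> d (Suc k) i" and e: "e (Suc k) i \<le> e k i" "e k (Suc i) \<le> e (Suc k) i" for i k
      using de by (auto simp: chain_def interlace_def)
    let ?p = "\<lambda>i j. if i \<le> j then d (j - i) i else e (i - j) j"
    \<comment> \<open>Three cases: above the main diagonal, below it, and the step that leaves it,
      where \<open>d 0 = e 0\<close> enters.\<close>
    have "?p (Suc i) k \<le> ?p i k" for i k
      using d(2)[of "k - Suc i" i] e(1)[of "i - k" k] e(1)[of 0 k] de(1)
      by (cases "Suc i \<le> k"; cases "i = k") (auto simp: Suc_diff_Suc Suc_diff_le)
    moreover have "?p k (Suc i) \<le> ?p k i" for i k
      using e(2)[of "k - Suc i" i] d(1)[of "i - k" k] e(2)[of 0 i] de(1)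
      by (cases "k \<le> i"; cases "k = Suc i") (auto simp: Suc_diff_Suc Suc_diff_le)
    ultimately have "antimono (\<lambda>i. ?p i k)" "antimono (\<lambda>i. ?p k i)" for k
      unfolding decseq_Suc_iff by blast+
    moreover have "?p 0 N = 0" "?p N 0 = 0" using de by (auto simp: chain_def)
    ultimately show "?p \<in> box_partitions N" unfolding box_partitions_def by blast
  qed
qed

lemma box_size_diagonals:
  assumes p: "p \<in> box_partitions N" and de: "diagonals p = (d, e)"
  shows "box_size N p = psize (d 0) + (\<Sum>k<N. psize (d (Suc k))) + (\<Sum>k<N. psize (e (Suc k)))"
proof -
  note z = box_partitions_zero[OF p]
  have d: "d k i = p i (i + k)" and e: "e k i = p (i + k) i" for k i
    using de by (auto simp: diagonals_def fun_eq_iff)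
  have shift: "(\<Sum>j<N. if i \<le> j then f j else 0) = (\<Sum>k<M. f (i + k))"
    if f: "\<And>j. j \<ge> N \<Longrightarrow> f j = 0" and M: "N \<le> i + M" for i M and f :: "nat \<Rightarrow> nat"
  proof -
    have "(\<Sum>k<M. f (i + k)) = sum f ((+) i ` {..<M})" by (simp add: sum.reindex)
    also have "\<dots> = (\<Sum>j<N. if i \<le> j then f j else 0)"
    proof (rule sum.mono_neutral_cong)
      show "f j = 0" if "j \<in> (+) i ` {..<M} - {..<N}" for j using that f by auto
      show "(if i \<le> j then f j else 0) = 0" if "j \<in> {..<N} - (+) i ` {..<M}" for j
      proof (cases "i \<le> j")
        case True
        hence "j = i + (j - i)" "j - i < M" using that M by auto
        hence "j \<in> (+) i ` {..<M}" by blast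
        thus ?thesis using that by simp
      qed simp
    qed auto
    finally show ?thesis by simp
  qed
  have pd: "psize (d k) = (\<Sum>i<N. p i (i + k))" and pe: "psize (e k) = (\<Sum>i<N. p (i + k) i)" for k
    by (subst psize_eq[of N]; simp add: d e z)+
  have "box_size N p = (\<Sum>i<N. \<Sum>j<N. (if i \<le> j then p i j else 0) + (if Suc j \<le> i then p i j else 0))"
    unfolding box_size_def by (intro sum.cong) auto
  also have "\<dots> = (\<Sum>i<N. \<Sum>j<N. if i \<le> j then p i j else 0) + (\<Sum>j<N. \<Sum>i<N. if Suc j \<le> i then p i j else 0)"
    by (simp only: sum.distrib) (subst (2) sum.swap, rule refl)
  \<comment> \<open>The range \<open>Suc N\<close> includes an empty diagonal, so that splitting off
    k = 0 leaves exactly N terms.\<close>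
  also have "(\<Sum>i<N. \<Sum>j<N. if i \<le> j then p i j else 0) = (\<Sum>i<N. \<Sum>k<Suc N. p i (i + k))"
    by (intro sum.cong refl shift) (auto simp: z)
  also have "\<dots> = (\<Sum>k<Suc N. psize (d k))" unfolding pd by (rule sum.swap)
  also have "\<dots> = psize (d 0) + (\<Sum>k<N. psize (d (Suc k)))" by (rule sum.lessThan_Suc_shift)
  also have "(\<Sum>j<N. \<Sum>i<N. if Suc j \<le> i then p i j else 0) = (\<Sum>j<N. \<Sum>k<N. p (Suc j + k) j)"
    by (intro sum.cong refl shift) (auto simp: z)
  also have "\<dots> = (\<Sum>k<N. psize (e (Suc k)))" unfolding pe by (subst sum.swap) simp
  finally show ?thesis .
qed

lemma esum_box_partitions:
  "(ESUM p. of_bool (p \<in> box_partitions N) * q ^ box_size N p) =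
   (\<Prod>j<N. \<Prod>i<N. geom (q * q ^ (i + j)))"
proof -
  let ?w = "\<lambda>d. q ^ (\<Sum>k<N. psize (d (Suc k)))"
  let ?B = "{(d, e). d 0 = e 0 \<and> chain N d \<and> chain N e}"
  let ?f = "\<lambda>(d, e). q ^ psize (d 0) * (?w d * ?w e)"
  have "(ESUM p. of_bool (p \<in> box_partitions N) * q ^ box_size N p) =
        (\<integral>\<^sup>+p. q ^ box_size N p \<partial>count_space (box_partitions N))"
    by (rule esum_restrict)
  also have "\<dots> = (\<integral>\<^sup>+p. ?f (diagonals p) \<partial>count_space (box_partitions N))"
    by (intro nn_integral_cong) (auto simp: box_size_diagonals power_add mult_ac split: prod.splits)
  also have "\<dots> = (\<integral>\<^sup>+z. ?f z \<partial>count_space ?B)"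
    by (rule nn_integral_bij_count_space[OF bij_betw_diagonals])
  also have "\<dots> = (ESUM z. of_bool (z \<in> ?B) * ?f z)" by (rule esum_restrict[symmetric])
  also have "\<dots> = (ESUM d. ESUM e. of_bool (d 0 = e 0 \<and> chain N d \<and> chain N e) * (q ^ psize (d 0) * (?w d * ?w e)))"
    by (subst esum_prod) simp
  \<comment> \<open>The shared main diagonal becomes a variable \<open>l\<close>; for fixed
    \<open>l\<close> the two chains are independent and their sums factor.\<close>
  also have "\<dots> = (ESUM d. ESUM e. ESUM l. of_bool (l = d 0) * (q ^ psize l *
       (of_bool (d 0 = l \<and> chain N d) * ?w d * (of_bool (e 0 = l \<and> chain N e) * ?w e))))"
    unfolding esum_delta by (intro nn_integral_cong) auto
  also have "\<dots> = (ESUM d. ESUM e. ESUM l. q ^ psize l *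
       (of_bool (d 0 = l \<and> chain N d) * ?w d * (of_bool (e 0 = l \<and> chain N e) * ?w e)))"
    by (intro nn_integral_cong) auto
  also have "\<dots> = (ESUM d. ESUM l. ESUM e. q ^ psize l *
       (of_bool (d 0 = l \<and> chain N d) * ?w d * (of_bool (e 0 = l \<and> chain N e) * ?w e)))"
    by (subst esum_swap) (rule refl)
  also have "\<dots> = (ESUM l. ESUM d. ESUM e. q ^ psize l *
       (of_bool (d 0 = l \<and> chain N d) * ?w d * (of_bool (e 0 = l \<and> chain N e) * ?w e)))"
    by (rule esum_swap)
  also have "\<dots> = (ESUM l. q ^ psize l * (principal_schur q N l * principal_schur q N l))"
    by (simp only: esum_cmult) (simp add: principal_schur_eq_esum_chain nn_integral_multc)
  also have "\<dots> = (\<Prod>j<N. \<Prod>i<N. geom (q * q ^ (i + j)))"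
    by (rule principal_schur_cauchy)
  finally show ?thesis .
qed

section \<open>Plane partitions confined to a square\<close>

lemma plane_partitions_imp_box:
  assumes "p \<in> plane_partitions n"
  shows "p \<in> box_partitions n"
proof -
  have mono: "\<forall>k. antimono (\<lambda>i. p i k) \<and> antimono (\<lambda>i. p k i)"
    and hs: "((\<lambda>(i, j). p i j) has_sum n) UNIV"
    using assms by (auto simp: plane_partitions_def)
  have le: "sum (\<lambda>(i, j). p i j) F \<le> n" if "finite F" for F
    by (rule has_sum_mono_neutral[OF has_sum_finite[OF that] hs]) auto
  \<comment> \<open>Otherwise n + 1 positive entries would sum to more than n. The embedding
    \<open>g\<close> covers the first row and the first column at once.\<close>
  have line: "f n = 0" if "antimono f" "\<And>k. f k = (\<lambda>(i, j). p i j) (g k)" "inj g" for f g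
  proof (rule ccontr)
    assume "f n \<noteq> 0"
    hence "1 \<le> f k" if "k \<le> n" for k using \<open>antimono f\<close> that unfolding antimono_def
      by (metis One_nat_def Suc_leI gr0I le_zero_eq)
    hence "(\<Sum>k\<le>n. 1) \<le> (\<Sum>k\<le>n. f k)" by (intro sum_mono) auto
    also have "\<dots> = sum (\<lambda>(i, j). p i j) (g ` {..n})"
      using \<open>inj g\<close> by (subst sum.reindex) (auto simp: that(2) inj_on_def)
    also have "\<dots> \<le> n" by (rule le) auto
    finally show False by simp
  qed
  have "p 0 n = 0" using mono by (intro line[of "\<lambda>k. p 0 k" "\<lambda>k. (0, k)"]) (auto simp: inj_on_def)
  moreover have "p n 0 = 0" using mono by (intro line[of "\<lambda>k. p k 0" "\<lambda>k. (k, 0)"]) (auto simp: inj_on_def)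
  ultimately show ?thesis using mono by (simp add: box_partitions_def)
qed

lemma box_partitions_mono: "N \<le> M \<Longrightarrow> box_partitions N \<subseteq> box_partitions M"
proof
  fix p assume "N \<le> M" "p \<in> box_partitions N"
  thus "p \<in> box_partitions M"
    using box_partitions_zero[of p N 0 M] box_partitions_zero[of p N M 0] by (auto simp: box_partitions_def)
qed

lemma box_partitions_plane_iff:
  assumes "p \<in> box_partitions N"
  shows "p \<in> plane_partitions n \<longleftrightarrow> box_size N p = n"
proof -
  have nz: "i < N \<and> j < N" if "p i j \<noteq> 0" for i j
    using box_partitions_zero[OF assms] that by (meson leI)
  have "((\<lambda>(i, j). p i j) has_sum box_size N p) ({..<N} \<times> {..<N})"
    unfolding box_size_def sum.cartesian_product by (rule has_sum_finite) simp
  hence "((\<lambda>(i, j). p i j) has_sum box_size N p) UNIV"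
    by (rule has_sum_cong_neutral[THEN iffD1, rotated -1]) (use nz in auto)
  moreover have "\<forall>k. antimono (\<lambda>i. p i k) \<and> antimono (\<lambda>i. p k i)"
    using assms by (simp add: box_partitions_def)
  ultimately show ?thesis unfolding plane_partitions_def using has_sum_unique by blast
qed

definition box_gf :: "nat \<Rightarrow> real \<Rightarrow> real" where
  "box_gf N x = (\<Prod>j<N. \<Prod>i<N. 1 / (1 - x ^ Suc (i + j)))"

lemma geom_ennreal:
  assumes "0 \<le> x" "x < 1"
  shows "geom (ennreal x) = ennreal (1 / (1 - x))"
proof -
  have "geom (ennreal x) = (\<Sum>n. ennreal (x ^ n))" using assms by (simp add: geom_def ennreal_power)
  also have "\<dots> = ennreal (\<Sum>n. x ^ n)" using assms by (intro suminf_ennreal2) auto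
  also have "(\<Sum>n. x ^ n) = 1 / (1 - x)" using assms by (intro suminf_geometric) auto
  finally show ?thesis .
qed

text \<open>The product is finite, so the identity in [0, \<infinity>] already yields convergence of
  the real series.\<close>

lemma box_count_sums:
  fixes x :: real
  assumes x: "0 \<le> x" "x < 1"
  shows "(\<lambda>n. real (card (plane_partitions n \<inter> box_partitions N)) * x ^ n) sums box_gf N x"
proof -
  let ?c = "\<lambda>n. card (plane_partitions n \<inter> box_partitions N)"
  have pos: "x ^ Suc m < 1" for m using power_decreasing[of 1 "Suc m" x] x by simp
  have nn: "0 \<le> box_gf N x" unfolding box_gf_def using pos
    by (intro prod_nonneg ballI divide_nonneg_nonneg) (auto simp: less_imp_le)
  have g: "geom (ennreal x * ennreal x ^ k) = ennreal (1 / (1 - x ^ Suc k))" for k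
    using geom_ennreal[of "x ^ Suc k"] x pos[of k] by (simp add: ennreal_power ennreal_mult)
  have "ennreal (box_gf N x) = (\<Prod>j<N. \<Prod>i<N. geom (ennreal x * ennreal x ^ (i + j)))"
    unfolding box_gf_def g using pos
    by (subst prod_ennreal prod_nonneg, auto intro!: prod_nonneg simp: less_imp_le prod_ennreal)+
  also have "\<dots> = (ESUM p. of_bool (p \<in> box_partitions N) * ennreal x ^ box_size N p)"
    by (rule esum_box_partitions[symmetric])
  also have "\<dots> = (ESUM p. ESUM n. of_bool (n = box_size N p) * (of_bool (p \<in> box_partitions N) * ennreal x ^ n))"
    unfolding esum_delta ..
  also have "\<dots> = (ESUM n. ESUM p. of_bool (n = box_size N p) * (of_bool (p \<in> box_partitions N) * ennreal x ^ n))"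
    by (rule esum_swap)
  also have "\<dots> = (ESUM n. ennreal (real (?c n) * x ^ n))"
  proof (intro nn_integral_cong)
    fix n
    have "(ESUM p. of_bool (n = box_size N p) * (of_bool (p \<in> box_partitions N) * ennreal x ^ n)) =
          (ESUM p. of_bool (p \<in> plane_partitions n \<inter> box_partitions N) * ennreal x ^ n)"
      by (intro nn_integral_cong) (auto simp: box_partitions_plane_iff)
    also have "\<dots> = (\<Sum>p\<in>plane_partitions n \<inter> box_partitions N. ennreal x ^ n)"
      by (subst esum_restrict, rule nn_integral_count_space_finite) (simp add: finite_plane_partitions)
    also have "\<dots> = ennreal (real (?c n) * x ^ n)"
    proof -
      have "ennreal (real (?c n) * x ^ n) = of_nat (?c n) * ennreal x ^ n"
        using x by (simp add: ennreal_mult ennreal_power ennreal_of_nat_eq_real_of_nat)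
      thus ?thesis by simp
    qed
    finally show "(ESUM p. of_bool (n = box_size N p) * (of_bool (p \<in> box_partitions N) * ennreal x ^ n)) =
          ennreal (real (?c n) * x ^ n)" .
  qed
  also have "\<dots> = (\<Sum>n. ennreal (real (?c n) * x ^ n))"
    by (rule nn_integral_count_space_nat)
  finally have "(\<lambda>n. ennreal (real (?c n) * x ^ n)) sums ennreal (box_gf N x)"
    by (simp add: sums_iff)
  thus ?thesis using x nn by (subst (asm) sums_ennreal) auto
qed

text \<open>A plane partition of n < N fits into the box, so the first N coefficients of the product
  are exact and the others are nonnegative.\<close>

lemma box_gf_ge_partial:
  assumes x: "0 \<le> x" "x < 1"
  shows "(\<Sum>n<N. real (PL n) * x ^ n) \<le> box_gf N x"
proof -
  have "(\<Sum>n<N. real (PL n) * x ^ n) = (\<Sum>n<N. real (card (plane_partitions n \<inter> box_partitions N)) * x ^ n)"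
  proof (intro sum.cong refl)
    fix n assume "n \<in> {..<N}"
    hence "plane_partitions n \<inter> box_partitions N = plane_partitions n"
      using plane_partitions_imp_box box_partitions_mono[of n N] by fastforce
    thus "real (PL n) * x ^ n = real (card (plane_partitions n \<inter> box_partitions N)) * x ^ n"
      by (simp add: PL_def)
  qed
  also have "\<dots> \<le> box_gf N x"
    using box_count_sums[OF x, of N] x by (intro sum_le_suminf[THEN order_trans]) (auto simp: sums_iff)
  finally show ?thesis .
qed

lemma box_gf_le:
  assumes x: "0 \<le> x" "x < 1" and s: "summable (\<lambda>n. real (PL n) * x ^ n)"
  shows "box_gf N x \<le> (\<Sum>n. real (PL n) * x ^ n)"
proof -
  have "card (plane_partitions n \<inter> box_partitions N) \<le> PL n" for n
    unfolding PL_def by (intro card_mono finite_plane_partitions) auto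
  thus ?thesis using x s box_count_sums[OF x, of N]
    by (intro sums_le[OF _ _ summable_sums[OF s]]) (auto intro!: mult_right_mono)
qed

text \<open>Adding 1 to the corner entry is injective and keeps rows and columns
  non-increasing.\<close>

lemma PL_mono: "PL n \<le> PL (Suc n)"
proof -
  let ?f = "\<lambda>p i j. p i j + (if i = 0 \<and> j = 0 then 1 else 0 :: nat)"
  have "inj_on ?f (plane_partitions n)"
    by (rule inj_onI) (auto simp: fun_eq_iff)
  moreover have "?f ` plane_partitions n \<subseteq> plane_partitions (Suc n)"
  proof clarify
    fix p assume p: "p \<in> plane_partitions n"
    have "((\<lambda>(i, j). if (i, j) = (0::nat, 0::nat) then 1 else 0) has_sum (1::nat)) UNIV"
    proof -
      have "((\<lambda>_. 1) has_sum (1::nat)) {(0::nat, 0::nat)}"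
        using has_sum_finite[of "{(0::nat, 0::nat)}" "\<lambda>_. 1::nat"] by simp
      also have "?this \<longleftrightarrow> ?thesis"
        by (rule has_sum_cong_neutral) (auto split: if_splits)
      finally show ?thesis .
    qed
    hence "((\<lambda>z. (\<lambda>(i, j). p i j) z + (\<lambda>(i, j). if (i, j) = (0, 0) then 1 else 0) z) has_sum (n + 1)) UNIV"
      using p by (intro has_sum_add) (auto simp: plane_partitions_def)
    moreover have "\<forall>k. antimono (\<lambda>i. ?f p i k) \<and> antimono (\<lambda>i. ?f p k i)"
      using p unfolding plane_partitions_def antimono_def by (auto simp: add_mono le_SucI)
    ultimately show "?f p \<in> plane_partitions (Suc n)"
      by (simp add: plane_partitions_def case_prod_unfold prod_eq_iff)
  qed
  ultimately show ?thesis unfolding PL_def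
    using card_inj_on_le finite_plane_partitions by blast
qed

lemma PL_pos: "0 < PL n"
proof (induction n)
  case 0
  have "(\<lambda>_ _. 0) \<in> plane_partitions 0"
    using has_sum_0[of UNIV "\<lambda>_::nat \<times> nat. 0::nat"]
    by (simp add: plane_partitions_def antimono_def case_prod_unfold)
  thus ?case unfolding PL_def using finite_plane_partitions[of 0]
    by (metis card_gt_0_iff empty_iff)
next
  case (Suc n)
  thus ?case using PL_mono[of n] by simp
qed

section \<open>The generating function near its singularity\<close>

text \<open>The term for \<open>m = 0\<close> is \<open>1 / 0 = 0\<close>, here and in the series below.\<close>
lemma zeta_3_sums: "(\<lambda>m. 1 / real m ^ 3) sums zeta 3"
proof -
  have "summable (\<lambda>m. 1 / real m ^ 3)"
    using inverse_power_summable[of 3, where 'a = real] by (simp add: divide_inverse)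
  hence "summable (\<lambda>m. 1 / real (Suc m) ^ 3)"
    by (subst summable_Suc_iff)
  moreover have "(\<lambda>m. 1 / real (Suc m) ^ 3) = (\<lambda>m. real (Suc m) powr (-3))"
    by (intro ext) (simp add: powr_minus_divide powr_numeral)
  ultimately have "(\<lambda>m. 1 / real (Suc m) ^ 3) sums zeta 3"
    unfolding zeta_def by (simp add: sums_iff)
  thus ?thesis by (subst (asm) sums_Suc_iff) simp
qed

lemma zeta_3_pos: "0 < zeta 3"
  using suminf_pos2[of "\<lambda>m. 1 / real m ^ 3" 1] zeta_3_sums by (simp add: sums_iff)

text \<open>In the power series of -ln(1 - x^(i+j+1)), the m-th term separates into a factor in i
  and the same factor in j, so the double sum over the box is a square.\<close>

lemma ln_box_gf_sums:
  assumes x: "0 \<le> x" "x < 1"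
  shows "(\<lambda>m. x ^ m / real m * (\<Sum>i<N. (x ^ m) ^ i)\<^sup>2) sums ln (box_gf N x)"
proof -
  have pos: "x ^ Suc m < 1" for m using power_decreasing[of 1 "Suc m" x] x by simp
  have ln_term: "(\<lambda>m. (x ^ Suc k) ^ m / real m) sums ln (1 / (1 - x ^ Suc k))" for k
  proof -
    have "(\<lambda>m. - ((- (- (x ^ Suc k))) ^ m) / of_nat m) sums ln (1 + (- (x ^ Suc k)))"
      using x pos[of k] by (intro ln_series') simp
    hence "(\<lambda>m. - (- ((- (- (x ^ Suc k))) ^ m) / of_nat m)) sums (- ln (1 + (- (x ^ Suc k))))"
      by (rule sums_minus)
    thus ?thesis using pos[of k] by (simp add: ln_div)
  qed
  have "(\<lambda>m. \<Sum>j<N. \<Sum>i<N. (x ^ Suc (i + j)) ^ m / real m) sums (\<Sum>j<N. \<Sum>i<N. ln (1 / (1 - x ^ Suc (i + j))))"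
    by (intro sums_sum ln_term)
  also have "(\<Sum>j<N. \<Sum>i<N. ln (1 / (1 - x ^ Suc (i + j)))) = ln (box_gf N x)"
  proof -
    have p: "1 / (1 - x ^ Suc k) \<noteq> 0" for k using pos[of k] by simp
    have "ln (box_gf N x) = (\<Sum>j<N. ln (\<Prod>i<N. 1 / (1 - x ^ Suc (i + j))))"
      unfolding box_gf_def by (intro ln_prod) (simp_all only: finite_lessThan prod_zero_iff p, simp)
    also have "\<dots> = (\<Sum>j<N. \<Sum>i<N. ln (1 / (1 - x ^ Suc (i + j))))"
      by (intro sum.cong refl ln_prod finite_lessThan p)
    finally show ?thesis by (rule sym)
  qed
  also have "(\<lambda>m. \<Sum>j<N. \<Sum>i<N. (x ^ Suc (i + j)) ^ m / real m) = (\<lambda>m. x ^ m / real m * (\<Sum>i<N. (x ^ m) ^ i)\<^sup>2)"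
  proof
    fix m
    have "(\<Sum>j<N. \<Sum>i<N. (x ^ Suc (i + j)) ^ m / real m) =
          (\<Sum>j<N. \<Sum>i<N. x ^ m / real m * ((x ^ m) ^ i * (x ^ m) ^ j))"
      by (intro sum.cong refl) (simp add: power_mult_distrib power_add flip: power_mult, simp add: mult_ac)
    also have "\<dots> = x ^ m / real m * ((\<Sum>i<N. (x ^ m) ^ i) * (\<Sum>j<N. (x ^ m) ^ j))"
      by (subst sum.swap, subst sum_product) (simp only: sum_distrib_left)
    finally show "(\<Sum>j<N. \<Sum>i<N. (x ^ Suc (i + j)) ^ m / real m) = x ^ m / real m * (\<Sum>i<N. (x ^ m) ^ i)\<^sup>2"
      by (simp add: power2_eq_square)
  qed
  finally show ?thesis .
qed

lemma box_gf_pos: "0 \<le> x \<Longrightarrow> x < 1 \<Longrightarrow> 0 < box_gf N x"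
  unfolding box_gf_def using power_decreasing[of 1 "Suc m" x for m]
  by (intro prod_pos ballI divide_pos_pos) (auto intro: le_less_trans)

text \<open>The left side is 1 / (4 sinh(s/2)^2), and sinh(s/2) \<ge> s/2.\<close>

lemma exp_over_square_le:
  fixes s :: real
  assumes "0 < s"
  shows "exp (- s) / (1 - exp (- s))\<^sup>2 \<le> 1 / s\<^sup>2"
proof -
  define y where "y = exp (- (s / 2))"
  have y: "0 < y" "y < 1" "exp (- s) = y\<^sup>2"
    using assms by (auto simp: y_def power2_eq_square exp_add[symmetric])
  have "s / 2 \<le> (exp (s / 2) - inverse (exp (s / 2))) / 2"
    using assms by (intro real_le_x_sinh) simp
  hence "s \<le> 1 / y - y" by (simp add: y_def exp_minus inverse_eq_divide)
  hence "s * y \<le> 1 - y\<^sup>2" using y by (simp add: field_simps power2_eq_square)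
  hence "(s * y)\<^sup>2 \<le> (1 - y\<^sup>2)\<^sup>2" using y assms by (intro power_mono) auto
  moreover have "0 < 1 - y\<^sup>2" using y by (simp add: power_less_one_iff)
  ultimately show ?thesis using assms y by (simp add: field_simps power_mult_distrib)
qed

text \<open>Bounding the geometric sums by 1 / (1 - y), the m-th term is at most 1 / (m (t m)^2).
  Uniformity in N later gives convergence of the full series, and the absence of an error term
  settles the upper half of the limit.\<close>

lemma ln_box_gf_le:
  assumes t: "0 < t"
  shows "ln (box_gf N (exp (- t))) \<le> zeta 3 / t\<^sup>2"
proof (rule sums_le)
  show "(\<lambda>m. exp (- t) ^ m / real m * (\<Sum>i<N. (exp (- t) ^ m) ^ i)\<^sup>2) sums ln (box_gf N (exp (- t)))"
    using t by (intro ln_box_gf_sums) auto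
  show "(\<lambda>m. 1 / real m ^ 3 / t\<^sup>2) sums (zeta 3 / t\<^sup>2)"
    by (intro sums_divide zeta_3_sums)
  show "exp (- t) ^ m / real m * (\<Sum>i<N. (exp (- t) ^ m) ^ i)\<^sup>2 \<le> 1 / real m ^ 3 / t\<^sup>2" for m
  proof (cases "m = 0")
    case False
    define y where "y = exp (- (t * real m))"
    have y: "exp (- t) ^ m = y" "0 < y" "y < 1"
      using t False by (auto simp: y_def exp_of_nat_mult[symmetric] mult.commute)
    have "(\<Sum>i<N. y ^ i) = (1 - y ^ N) / (1 - y)" using y by (simp add: sum_gp_strict)
    also have "\<dots> \<le> 1 / (1 - y)" using y by (intro divide_right_mono) auto
    finally have "(\<Sum>i<N. y ^ i)\<^sup>2 \<le> (1 / (1 - y))\<^sup>2"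
      using y by (intro power_mono sum_nonneg) auto
    hence "y / real m * (\<Sum>i<N. y ^ i)\<^sup>2 \<le> y / real m * (1 / (1 - y))\<^sup>2"
      using y by (intro mult_left_mono) auto
    also have "\<dots> = (y / (1 - y)\<^sup>2) / real m" by (simp add: power_divide)
    also have "\<dots> \<le> (1 / (t * real m)\<^sup>2) / real m"
      unfolding y_def using t False by (intro divide_right_mono exp_over_square_le) auto
    also have "\<dots> = 1 / real m ^ 3 / t\<^sup>2"
      by (simp add: power_mult_distrib power2_eq_square power3_eq_cube)
    finally show ?thesis by (simp add: y)
  qed simp
qed

lemma PL_partial_sum_le:
  assumes "0 < t"
  shows "(\<Sum>n<N. real (PL n) * exp (- (t * real n))) \<le> exp (zeta 3 / t\<^sup>2)"
proof -
  have "(\<Sum>n<N. real (PL n) * exp (- t) ^ n) \<le> box_gf N (exp (- t))"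
    using assms by (intro box_gf_ge_partial) auto
  also have "\<dots> \<le> exp (zeta 3 / t\<^sup>2)"
    using ln_box_gf_le[OF assms, of N] box_gf_pos[of "exp (- t)" N] assms by (simp add: ln_le_cancel_iff[symmetric, of _ "exp _"])
  finally show ?thesis by (simp add: exp_of_nat_mult[symmetric] mult.commute)
qed

lemma summable_PL:
  assumes "0 < t"
  shows "summable (\<lambda>n. real (PL n) * exp (- (t * real n)))"
  by (rule summableI_nonneg_bounded) (use PL_partial_sum_le[OF assms] in auto)

text \<open>With only M terms kept, N can tend to infinity term by term; the dropped terms are
  nonnegative.\<close>

lemma ln_PL_gf_ge:
  assumes t: "0 < t"
  shows "(\<Sum>m<M. exp (- (t * real m)) / real m / (1 - exp (- (t * real m)))\<^sup>2) \<le>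
           ln (\<Sum>n. real (PL n) * exp (- (t * real n)))"
proof (rule LIMSEQ_le_const2)
  let ?g = "\<lambda>N m. exp (- t) ^ m / real m * (\<Sum>i<N. (exp (- t) ^ m) ^ i)\<^sup>2"
  have x: "exp (- t) ^ n = exp (- (t * real n))" for n
    by (simp add: exp_of_nat_mult[symmetric] mult.commute)
  show "(\<lambda>N. \<Sum>m<M. ?g N m) \<longlonglongrightarrow> (\<Sum>m<M. exp (- (t * real m)) / real m / (1 - exp (- (t * real m)))\<^sup>2)"
  proof (intro tendsto_sum)
    fix m
    show "(\<lambda>N. ?g N m) \<longlonglongrightarrow> exp (- (t * real m)) / real m / (1 - exp (- (t * real m)))\<^sup>2"
    proof (cases "m = 0")
      case False
      define y where "y = exp (- (t * real m))"
      have "norm y < 1" using t False by (simp add: y_def)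
      hence "(\<lambda>N. \<Sum>i<N. y ^ i) \<longlonglongrightarrow> 1 / (1 - y)"
        using geometric_sums[of y] unfolding sums_def by blast
      hence "(\<lambda>N. y / real m * (\<Sum>i<N. y ^ i)\<^sup>2) \<longlonglongrightarrow> y / real m * (1 / (1 - y))\<^sup>2"
        by (intro tendsto_intros)
      thus ?thesis by (simp add: x y_def power_divide)
    qed simp
  qed
  have "(\<Sum>m<M. ?g N m) \<le> ln (\<Sum>n. real (PL n) * exp (- (t * real n)))" for N
  proof -
    have gs: "?g N sums ln (box_gf N (exp (- t)))" using t by (intro ln_box_gf_sums) auto
    have "(\<Sum>m<M. ?g N m) \<le> ln (box_gf N (exp (- t)))"
      using sum_le_suminf[OF sums_summable[OF gs], of "{..<M}"] sums_unique[OF gs] by simp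
    also have "box_gf N (exp (- t)) \<le> (\<Sum>n. real (PL n) * exp (- t) ^ n)"
      using t summable_PL[OF t] by (intro box_gf_le) (auto simp: x)
    hence "ln (box_gf N (exp (- t))) \<le> ln (\<Sum>n. real (PL n) * exp (- t) ^ n)"
      using box_gf_pos[of "exp (- t)" N] t by (subst ln_le_cancel_iff) auto
    finally show ?thesis by (simp add: x)
  qed
  thus "\<exists>N. \<forall>n\<ge>N. (\<Sum>m<M. ?g n m) \<le> ln (\<Sum>n. real (PL n) * exp (- (t * real n)))" by blast
qed

lemma ln_PL_gf_tendsto:
  "((\<lambda>t. t\<^sup>2 * ln (\<Sum>n. real (PL n) * exp (- (t * real n)))) \<longlongrightarrow> zeta 3) (at_right 0)"
proof (rule order_tendstoI)
  fix b assume b: "zeta 3 < b"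
  have "eventually (\<lambda>t::real. 0 < t) (at_right 0)" by (rule eventually_at_right_less)
  thus "eventually (\<lambda>t. t\<^sup>2 * ln (\<Sum>n. real (PL n) * exp (- (t * real n))) < b) (at_right 0)"
  proof eventually_elim
    case (elim t)
    have le: "(\<Sum>n. real (PL n) * exp (- (t * real n))) \<le> exp (zeta 3 / t\<^sup>2)"
      using PL_partial_sum_le[OF elim] summable_PL[OF elim] by (intro suminf_le_const) auto
    have "0 < (\<Sum>n. real (PL n) * exp (- (t * real n)))"
      using PL_pos by (intro suminf_pos summable_PL elim) (auto simp: Suc_le_eq)
    hence "ln (\<Sum>n. real (PL n) * exp (- (t * real n))) \<le> zeta 3 / t\<^sup>2"
      using le by (metis exp_gt_zero ln_exp ln_le_cancel_iff)
    thus ?case using elim b by (simp add: field_simps)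
  qed
next
  \<comment> \<open>M is fixed before t tends to 0. Each of the finitely many terms converges
    because exp(-s) / (1 - exp(-s))^2 behaves like 1 / s^2 at 0.\<close>
  fix b assume "b < zeta 3"
  hence "eventually (\<lambda>M. b < (\<Sum>m<M. 1 / real m ^ 3)) sequentially"
    using zeta_3_sums unfolding sums_def by (rule order_tendstoD(1)[rotated])
  then obtain M where M: "b < (\<Sum>m<M. 1 / real m ^ 3)"
    by (auto dest: eventually_happens)
  have "((\<lambda>t. t\<^sup>2 * (exp (- (t * real m)) / real m / (1 - exp (- (t * real m)))\<^sup>2)) \<longlongrightarrow> 1 / real m ^ 3) (at_right 0)" for m
  proof (cases "m = 0")
    case False
    define c where "c = real m"
    have "c > 0" using False by (simp add: c_def)
    hence "((\<lambda>t. t\<^sup>2 * (exp (- (t * c)) / c / (1 - exp (- (t * c)))\<^sup>2)) \<longlongrightarrow> inverse c * inverse (c\<^sup>2)) (at_right 0)"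
      by real_asymp
    thus ?thesis by (simp add: c_def field_simps power2_eq_square power3_eq_cube)
  qed simp
  hence "((\<lambda>t. \<Sum>m<M. t\<^sup>2 * (exp (- (t * real m)) / real m / (1 - exp (- (t * real m)))\<^sup>2)) \<longlongrightarrow> (\<Sum>m<M. 1 / real m ^ 3)) (at_right 0)"
    by (intro tendsto_sum)
  hence "eventually (\<lambda>t. b < (\<Sum>m<M. t\<^sup>2 * (exp (- (t * real m)) / real m / (1 - exp (- (t * real m)))\<^sup>2))) (at_right 0)"
    using M by (rule order_tendstoD(1))
  moreover have "eventually (\<lambda>t::real. 0 < t) (at_right 0)" by (rule eventually_at_right_less)
  ultimately show "eventually (\<lambda>t. b < t\<^sup>2 * ln (\<Sum>n. real (PL n) * exp (- (t * real n)))) (at_right 0)"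
  proof eventually_elim
    case (elim t)
    have "t\<^sup>2 * (\<Sum>m<M. exp (- (t * real m)) / real m / (1 - exp (- (t * real m)))\<^sup>2) \<le>
            t\<^sup>2 * ln (\<Sum>n. real (PL n) * exp (- (t * real n)))"
      using elim by (intro mult_left_mono ln_PL_gf_ge) auto
    thus ?case using elim(1) by (simp add: sum_distrib_left)
  qed
qed

section \<open>From the Laplace transform to the coefficients\<close>

text \<open>The three terms bound the contributions of \<open>m > n\<close>, of \<open>m \<le> r\<close> and of \<open>r < m \<le> n\<close>.\<close>
lemma laplace_truncation:
  fixes a :: "nat \<Rightarrow> real" and n :: nat and r :: real
  assumes nonneg: "\<And>m. 0 \<le> a m" and mono: "mono a"
    and summ: "\<And>t. 0 < t \<Longrightarrow> summable (\<lambda>m. a m * exp (- (t * real m)))"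
    and t: "0 < u" "u \<le> t" "t \<le> v"
  shows "(\<Sum>m. a m * exp (- (t * real m))) \<le>
           exp (- ((t - u) * real n)) * (\<Sum>m. a m * exp (- (u * real m))) +
           exp ((v - t) * r) * (\<Sum>m. a m * exp (- (v * real m))) +
           (real n + 1) * (a n * exp (- (t * r)))"
proof -
  let ?f = "\<lambda>t m. a m * exp (- (t * real m))"
  let ?g = "\<lambda>m. exp (- ((t - u) * real n)) * ?f u m + exp ((v - t) * r) * ?f v m +
                (if m \<in> {..n} then a n * exp (- (t * r)) else 0)"
  have "?f t m \<le> ?g m" for m
  proof -
    have nn: "0 \<le> exp (- ((t - u) * real n)) * ?f u m" "0 \<le> exp ((v - t) * r) * ?f v m"
      "0 \<le> (if m \<in> {..n} then a n * exp (- (t * r)) else 0)" using nonneg by auto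
    \<comment> \<open>The tilting factor is compared with its value at n or at r; between them
      \<open>mono\<close> replaces \<open>a m\<close> by \<open>a n\<close>. Overlapping cases do no
      harm, as all three bounds are nonnegative.\<close>
    consider "m > n" | "real m \<le> r" | "m \<le> n" "r < real m" by linarith
    hence "?f t m \<le> exp (- ((t - u) * real n)) * ?f u m \<or> ?f t m \<le> exp ((v - t) * r) * ?f v m \<or>
           ?f t m \<le> (if m \<in> {..n} then a n * exp (- (t * r)) else 0)"
    proof cases
      case 1
      have "(t - u) * real n \<le> (t - u) * real m" using 1 t by (intro mult_left_mono) auto
      hence "exp (- (t * real m)) \<le> exp (- ((t - u) * real n)) * exp (- (u * real m))"
        unfolding exp_add[symmetric] by (simp add: algebra_simps)
      hence "?f t m \<le> a m * (exp (- ((t - u) * real n)) * exp (- (u * real m)))"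
        using nonneg by (intro mult_left_mono) auto
      thus ?thesis by (simp add: mult_ac)
    next
      case 2
      have "(v - t) * real m \<le> (v - t) * r" using 2 t by (intro mult_left_mono) auto
      hence "exp (- (t * real m)) \<le> exp ((v - t) * r) * exp (- (v * real m))"
        unfolding exp_add[symmetric] by (simp add: algebra_simps)
      hence "?f t m \<le> a m * (exp ((v - t) * r) * exp (- (v * real m)))"
        using nonneg by (intro mult_left_mono) auto
      thus ?thesis by (simp add: mult_ac)
    next
      case 3
      have "exp (- (t * real m)) \<le> exp (- (t * r))" using 3 t by simp
      hence "?f t m \<le> a n * exp (- (t * r))"
        using 3 mono nonneg by (intro mult_mono) (auto dest: monoD)
      thus ?thesis using 3 by simp
    qed
    thus ?thesis using nn by linarith
  qed
  moreover have "?f t sums (\<Sum>m. ?f t m)" using t by (intro summable_sums summ) auto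
  moreover have "?g sums (exp (- ((t - u) * real n)) * (\<Sum>m. ?f u m) + exp ((v - t) * r) * (\<Sum>m. ?f v m) +
                     (\<Sum>m\<in>{..n}. a n * exp (- (t * r))))"
    using t by (intro sums_add sums_mult summable_sums summ sums_If_finite_set) auto
  ultimately have "(\<Sum>m. ?f t m) \<le> exp (- ((t - u) * real n)) * (\<Sum>m. ?f u m) + exp ((v - t) * r) * (\<Sum>m. ?f v m) +
                     (\<Sum>m\<in>{..n}. a n * exp (- (t * r)))"
    by (rule sums_le)
  thus ?thesis by (simp add: add.commute)
qed

text \<open>For the lower bound the series is taken at t = (1 + d) u, where its mass sits near n /
  (1 + d)^3, strictly between r = n / (1 + 2 d)^3 and n. The tilts u and (1 + 2 d) u are the
  minimisers of \<open>s * m + Z / s^2\<close> for m = n and m = r.\<close>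

lemma tauberian_ln_coeff:
  fixes a :: "nat \<Rightarrow> real" and Z :: real
  assumes a0: "\<And>m. 0 < a m" and mono: "mono a" and Z: "0 < Z"
    and summ: "\<And>t. 0 < t \<Longrightarrow> summable (\<lambda>m. a m * exp (- (t * real m)))"
    and lim: "((\<lambda>t. t\<^sup>2 * ln (\<Sum>m. a m * exp (- (t * real m)))) \<longlongrightarrow> Z) (at_right 0)"
  shows "(\<lambda>n. ((2 * Z / real n) powr (1 / 3))\<^sup>2 * ln (a n)) \<longlonglongrightarrow> 3 * Z"
proof -
  define F where "F t = (\<Sum>m. a m * exp (- (t * real m)))" for t
  define h where "h t = t\<^sup>2 * ln (F t)" for t
  define u where "u n = (2 * Z / real n) powr (1 / 3)" for n
  have F_term: "a n * exp (- (t * real n)) \<le> F t" if "0 < t" for t n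
    unfolding F_def using sum_le_suminf[OF summ[OF that], of "{n}"] a0 by (simp add: less_imp_le)
  have F_pos: "0 < F t" if "0 < t" for t
    using F_term[OF that, of 0] a0[of 0] by simp
  have F_exp: "F t = exp (h t / t\<^sup>2)" if "0 < t" for t
    using F_pos[OF that] that by (simp add: h_def)
  have upos: "0 < u n" if "0 < n" for n using that Z by (simp add: u_def)
  \<comment> \<open>The equation of the minimiser; it puts every exponent on the common scale 1 /
    u^2.\<close>
  have u3: "u n * real n = 2 * Z / (u n)\<^sup>2" if "0 < n" for n
  proof -
    have "u n ^ 3 = (2 * Z / real n) powr (1 / 3 * 3)"
      unfolding u_def using that Z by (subst powr_powr[symmetric]) (simp add: powr_numeral)
    hence "u n ^ 3 = 2 * Z / real n" using that Z by simp
    thus ?thesis using that upos[OF that] by (simp add: field_simps power2_eq_square power3_eq_cube)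
  qed
  \<comment> \<open>The price of the n + 1 terms of the window and of a factor 2 is negligible on
    that scale.\<close>
  have u_log: "(\<lambda>n. (u n)\<^sup>2 * ln (2 * (real n + 1))) \<longlonglongrightarrow> 0"
    unfolding u_def using Z by real_asymp
  have u_inv: "filterlim (\<lambda>n. 1 / (u n)\<^sup>2) at_top sequentially"
    unfolding u_def using Z by real_asymp
  have h_lim: "(\<lambda>n. h (c * u n)) \<longlonglongrightarrow> Z" if "0 < c" for c
  proof -
    have "filterlim (\<lambda>n. c * u n) (at_right 0) sequentially"
      unfolding u_def using Z that by real_asymp
    thus ?thesis using lim unfolding h_def F_def by (rule filterlim_compose[rotated])
  qed
  have ev0: "eventually (\<lambda>n. 0 < n) sequentially" by (rule eventually_gt_at_top)
  have upper: "eventually (\<lambda>n. (u n)\<^sup>2 * ln (a n) \<le> 2 * Z + h (u n)) sequentially"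
    using ev0
  proof eventually_elim
    case (elim n)
    have "ln (a n * exp (- (u n * real n))) \<le> ln (F (u n))"
      using F_term[OF upos[OF elim], of n] a0[of n] F_pos[OF upos[OF elim]] by simp
    hence "ln (a n) \<le> u n * real n + ln (F (u n))" using a0[of n] by (simp add: ln_mult)
    hence "(u n)\<^sup>2 * ln (a n) \<le> (u n)\<^sup>2 * (u n * real n + ln (F (u n)))"
      by (rule mult_left_mono) auto
    thus ?case using u3[OF elim] upos[OF elim] by (simp add: h_def distrib_left)
  qed
  have lower: "eventually (\<lambda>n. h ((1 + d) * u n) / (1 + d)\<^sup>2 + 2 * Z * (1 + d) / (1 + 2 * d) ^ 3
                  - (u n)\<^sup>2 * ln (2 * (real n + 1)) \<le> (u n)\<^sup>2 * ln (a n)) sequentially"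
    if d: "0 < d" for d
  proof -
    \<comment> \<open>A strict gap between limiting exponents, multiplied by 1 / u^2, beats any
      constant. With 4, the two tails take at most half of \<open>F t\<close>, which causes the
      factor 2 below.\<close>
    have small: "eventually (\<lambda>n. exp (g n / (u n)\<^sup>2) \<le> exp (h ((1 + d) * u n) / (1 + d)\<^sup>2 / (u n)\<^sup>2) / 4) sequentially"
      if g: "g \<longlonglongrightarrow> L" "L < Z / (1 + d)\<^sup>2" for g L
    proof -
      have "(\<lambda>n. h ((1 + d) * u n) / (1 + d)\<^sup>2 - g n) \<longlonglongrightarrow> Z / (1 + d)\<^sup>2 - L"
        using d by (intro tendsto_intros h_lim g) auto
      hence "filterlim (\<lambda>n. (h ((1 + d) * u n) / (1 + d)\<^sup>2 - g n) * (1 / (u n)\<^sup>2)) at_top sequentially"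
        using g by (intro filterlim_tendsto_pos_mult_at_top[OF _ _ u_inv]) auto
      hence "eventually (\<lambda>n. ln 4 \<le> (h ((1 + d) * u n) / (1 + d)\<^sup>2 - g n) * (1 / (u n)\<^sup>2)) sequentially"
        by (simp add: filterlim_at_top)
      thus ?thesis
      proof eventually_elim
        case (elim n)
        hence "g n / (u n)\<^sup>2 + ln 4 \<le> h ((1 + d) * u n) / (1 + d)\<^sup>2 / (u n)\<^sup>2"
          by (simp add: diff_divide_distrib)
        hence "exp (g n / (u n)\<^sup>2 + ln 4) \<le> exp (h ((1 + d) * u n) / (1 + d)\<^sup>2 / (u n)\<^sup>2)" by simp
        thus ?case by (simp add: exp_add)
      qed
    qed
    \<comment> \<open>Scaled by u^2, this says that \<open>s * n + Z / s^2\<close> is smaller at its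
      minimiser u than at t; \<open>c2\<close> is the same with r for n and minimiser (1 + 2 d) u.
      Hence the gaps are of second order in d.\<close>
    have c1: "Z * (1 - 2 * d) < Z / (1 + d)\<^sup>2"
    proof -
      have "0 < d\<^sup>2 * 3 + d ^ 3 * 2" using d by (intro add_pos_pos) auto
      hence "(1 - 2 * d) * (1 + d)\<^sup>2 < 1" by (simp add: algebra_simps power2_eq_square power3_eq_cube)
      hence "1 - 2 * d < 1 / (1 + d)\<^sup>2" using d by (subst pos_less_divide_eq) auto
      thus ?thesis using Z by (metis mult.right_neutral mult_strict_left_mono times_divide_eq_right)
    qed
    have c2: "Z / (1 + 2 * d)\<^sup>2 + 2 * Z * d / (1 + 2 * d) ^ 3 < Z / (1 + d)\<^sup>2"
    proof -
      have "0 < d\<^sup>2 * 3 + d ^ 3 * 4" using d by (intro add_pos_pos) auto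
      hence "(1 + 4 * d) * (1 + d)\<^sup>2 < (1 + 2 * d) ^ 3"
        by (simp add: algebra_simps power2_eq_square power3_eq_cube)
      hence "(1 + 4 * d) / (1 + 2 * d) ^ 3 < 1 / (1 + d)\<^sup>2"
        using d by (subst frac_less_eq) (auto simp: divide_less_0_iff mult_ac intro!: divide_neg_pos)
      hence "Z * ((1 + 4 * d) / (1 + 2 * d) ^ 3) < Z * (1 / (1 + d)\<^sup>2)"
        using Z by (rule mult_strict_left_mono)
      moreover have "Z / (1 + 2 * d)\<^sup>2 = Z * (1 + 2 * d) / (1 + 2 * d) ^ 3"
        using d by (simp add: power2_eq_square power3_eq_cube)
      hence "Z / (1 + 2 * d)\<^sup>2 + 2 * Z * d / (1 + 2 * d) ^ 3 = Z * ((1 + 4 * d) / (1 + 2 * d) ^ 3)"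
        by (simp add: add_divide_distrib[symmetric] algebra_simps)
      ultimately show ?thesis by simp
    qed
    have l1: "(\<lambda>n. h (1 * u n) - 2 * Z * d) \<longlonglongrightarrow> Z - 2 * Z * d"
      by (intro tendsto_intros h_lim) auto
    have l2: "(\<lambda>n. h ((1 + 2 * d) * u n) / (1 + 2 * d)\<^sup>2 + 2 * Z * d / (1 + 2 * d) ^ 3) \<longlonglongrightarrow>
                Z / (1 + 2 * d)\<^sup>2 + 2 * Z * d / (1 + 2 * d) ^ 3"
      using d by (intro tendsto_intros h_lim) auto
    have c1': "Z - 2 * Z * d < Z / (1 + d)\<^sup>2" using c1 by (simp add: algebra_simps)
    show ?thesis
      using small[OF l1 c1'] small[OF l2 c2] ev0
    proof eventually_elim
      case (elim n)
      define w where "w = 1 / (u n)\<^sup>2"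
      define t where "t = (1 + d) * u n"
      define r where "r = real n / (1 + 2 * d) ^ 3"
      have up: "0 < u n" using upos elim by simp
      have t: "0 < t" "u n \<le> t" "t \<le> (1 + 2 * d) * u n" using d up by (auto simp: t_def)
      have un: "u n * real n = 2 * Z * w" using u3 elim by (simp add: w_def)
      have Ft: "F t = exp (h t / (1 + d)\<^sup>2 / (u n)\<^sup>2)"
        using F_exp[OF t(1)] by (simp add: t_def power_mult_distrib)
      have "exp (- ((t - u n) * real n)) * F (u n) = exp ((h (1 * u n) - 2 * Z * d) / (u n)\<^sup>2)"
      proof -
        have "(t - u n) * real n = d * (u n * real n)" by (simp add: t_def algebra_simps)
        also have "\<dots> = 2 * Z * d / (u n)\<^sup>2" by (simp add: un w_def)
        finally show ?thesis unfolding F_exp[OF up]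
          by (simp add: exp_add[symmetric] diff_divide_distrib)
      qed
      hence T1: "exp (- ((t - u n) * real n)) * F (u n) \<le> F t / 4"
        using elim(1) by (simp only: Ft t_def[symmetric])
      have "exp (((1 + 2 * d) * u n - t) * r) * F ((1 + 2 * d) * u n) =
             exp ((h ((1 + 2 * d) * u n) / (1 + 2 * d)\<^sup>2 + 2 * Z * d / (1 + 2 * d) ^ 3) / (u n)\<^sup>2)"
      proof -
        have "((1 + 2 * d) * u n - t) * r = d * (u n * real n) / (1 + 2 * d) ^ 3"
          by (simp add: t_def r_def algebra_simps)
        also have "\<dots> = 2 * Z * d / (1 + 2 * d) ^ 3 / (u n)\<^sup>2" unfolding un w_def by (simp add: mult_ac)
        finally have eq: "((1 + 2 * d) * u n - t) * r = 2 * Z * d / (1 + 2 * d) ^ 3 / (u n)\<^sup>2" .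
        have "0 < (1 + 2 * d) * u n" using d up by simp
        thus ?thesis unfolding eq using F_exp[of "(1 + 2 * d) * u n"]
          by (simp add: exp_add[symmetric] add_divide_distrib power_mult_distrib add.commute)
      qed
      hence T2: "exp (((1 + 2 * d) * u n - t) * r) * F ((1 + 2 * d) * u n) \<le> F t / 4"
        using elim(2) by (simp only: Ft t_def[symmetric])
      have bound: "F t \<le> exp (- ((t - u n) * real n)) * F (u n) +
              exp (((1 + 2 * d) * u n - t) * r) * F ((1 + 2 * d) * u n) +
              (real n + 1) * (a n * exp (- (t * r)))"
        unfolding F_def using a0 by (intro laplace_truncation mono summ up t) (auto simp: less_imp_le)
      have "F t \<le> 2 * (real n + 1) * (a n * exp (- (t * r)))"
      proof -
        have "x \<le> 2 * k * c" if "x \<le> A + B + k * c" "A \<le> x / 4" "B \<le> x / 4" for x A B k c :: real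
          using that unfolding mult.assoc by linarith
        from this[OF bound T1 T2] show ?thesis .
      qed
      hence "ln (F t) \<le> ln (2 * (real n + 1) * (a n * exp (- (t * r))))"
        by (rule ln_mono[OF _ F_pos[OF t(1)]])
      also have "\<dots> = ln (2 * (real n + 1)) + (ln (a n) + ln (exp (- (t * r))))"
        using a0[of n] by (subst ln_mult_pos, simp, simp, subst ln_mult_pos) simp_all
      finally have "ln (F t) + t * r - ln (2 * (real n + 1)) \<le> ln (a n)"
        unfolding ln_exp by linarith
      hence le: "(u n)\<^sup>2 * (ln (F t) + t * r - ln (2 * (real n + 1))) \<le> (u n)\<^sup>2 * ln (a n)"
        by (rule mult_left_mono) auto
      have e1: "(u n)\<^sup>2 * ln (F t) = h t / (1 + d)\<^sup>2"
        using up d by (simp add: h_def t_def power_mult_distrib)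
      have e2: "(u n)\<^sup>2 * (t * r) = 2 * Z * (1 + d) / (1 + 2 * d) ^ 3"
      proof -
        have "t * r = (1 + d) * (u n * real n) / (1 + 2 * d) ^ 3" by (simp add: t_def r_def)
        thus ?thesis using up by (simp add: un w_def)
      qed
      have "x * (p + q - l) = P + Q - x * l" if "x * p = P" "x * q = Q" for x p q l P Q :: real
        using that by (simp add: distrib_left right_diff_distrib)
      from le[unfolded this[OF e1 e2]] show ?case unfolding t_def .
    qed
  qed
  show ?thesis unfolding u_def[symmetric]
  proof (rule order_tendstoI)
    fix b assume b: "3 * Z < b"
    have "(\<lambda>n. 2 * Z + h (1 * u n)) \<longlonglongrightarrow> 2 * Z + Z" by (intro tendsto_intros h_lim) auto
    hence "eventually (\<lambda>n. 2 * Z + h (1 * u n) < b) sequentially"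
      by (rule order_tendstoD(2)) (use b in simp)
    thus "eventually (\<lambda>n. (u n)\<^sup>2 * ln (a n) < b) sequentially"
      using upper by eventually_elim simp
  next
    fix b assume b: "b < 3 * Z"
    \<comment> \<open>The lower bound tends to Z + 2 Z as d tends to 0, so a fixed d > 0 already
      beats b; only then does n grow.\<close>
    have "((\<lambda>d. Z / (1 + d)\<^sup>2 + 2 * Z * (1 + d) / (1 + 2 * d) ^ 3) \<longlongrightarrow> Z / (1 + 0)\<^sup>2 + 2 * Z * (1 + 0) / (1 + 2 * 0) ^ 3) (at_right 0)"
      by (intro tendsto_intros) auto
    hence "eventually (\<lambda>d. b < Z / (1 + d)\<^sup>2 + 2 * Z * (1 + d) / (1 + 2 * d) ^ 3) (at_right 0)"
      by (rule order_tendstoD(1)) (use b in simp)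
    moreover have "eventually (\<lambda>d::real. 0 < d) (at_right 0)" by (rule eventually_at_right_less)
    ultimately have "eventually (\<lambda>d. 0 < d \<and> b < Z / (1 + d)\<^sup>2 + 2 * Z * (1 + d) / (1 + 2 * d) ^ 3) (at_right 0)"
      by eventually_elim simp
    then obtain d where d: "0 < d" "b < Z / (1 + d)\<^sup>2 + 2 * Z * (1 + d) / (1 + 2 * d) ^ 3"
      using eventually_happens'[OF trivial_limit_at_right_real] by blast
    have "(\<lambda>n. h ((1 + d) * u n) / (1 + d)\<^sup>2 + 2 * Z * (1 + d) / (1 + 2 * d) ^ 3
                  - (u n)\<^sup>2 * ln (2 * (real n + 1))) \<longlonglongrightarrow> Z / (1 + d)\<^sup>2 + 2 * Z * (1 + d) / (1 + 2 * d) ^ 3 - 0"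
      using d by (intro tendsto_intros h_lim u_log) auto
    hence "eventually (\<lambda>n. b < h ((1 + d) * u n) / (1 + d)\<^sup>2 + 2 * Z * (1 + d) / (1 + 2 * d) ^ 3
                  - (u n)\<^sup>2 * ln (2 * (real n + 1))) sequentially"
      by (rule order_tendstoD(1)) (use d in simp)
    thus "eventually (\<lambda>n. b < (u n)\<^sup>2 * ln (a n)) sequentially"
      using lower[OF d(1)] by eventually_elim linarith
  qed
qed

theorem theorem1p3:
  shows "(\<lambda>n::nat. ln (real (PL n))) \<sim>[at_top]
         (\<lambda>n. (27 * zeta 3 / 4) powr (1 / 3) * real n powr (2 / 3))"
proof (rule asymp_equivI')
  let ?Z = "zeta 3"
  let ?u = "\<lambda>n. (2 * ?Z / real n) powr (1 / 3)"
  have "(\<lambda>n. (?u n)\<^sup>2 * ln (real (PL n))) \<longlonglongrightarrow> 3 * ?Z"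
  proof (rule tauberian_ln_coeff)
    show "mono (\<lambda>n. real (PL n))" by (intro incseq_SucI) (simp add: PL_mono)
  qed (use PL_pos zeta_3_pos summable_PL ln_PL_gf_tendsto in auto)
  hence "(\<lambda>n. (?u n)\<^sup>2 * ln (real (PL n)) / (3 * ?Z)) \<longlonglongrightarrow> 3 * ?Z / (3 * ?Z)"
    using zeta_3_pos by (intro tendsto_divide) auto
  hence "(\<lambda>n. (?u n)\<^sup>2 * ln (real (PL n)) / (3 * ?Z)) \<longlonglongrightarrow> 1"
    using zeta_3_pos by simp
  moreover have "eventually (\<lambda>n. (?u n)\<^sup>2 * ln (real (PL n)) / (3 * ?Z) =
      ln (real (PL n)) / ((27 * ?Z / 4) powr (1 / 3) * real n powr (2 / 3))) at_top"
    using eventually_gt_at_top[of 0]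
  proof eventually_elim
    case (elim n)
    have u2: "(?u n)\<^sup>2 = (2 * ?Z) powr (2 / 3) / real n powr (2 / 3)"
    proof -
      have "(?u n)\<^sup>2 = ?u n * ?u n" by (simp add: power2_eq_square)
      also have "\<dots> = (2 * ?Z / real n) powr (2 / 3)" by (simp flip: powr_add)
      finally show ?thesis using zeta_3_pos elim by (simp add: powr_divide)
    qed
    \<comment> \<open>The constants match because (27 Z / 4) (2 Z)^2 = (3 Z)^3.\<close>
    have "(27 * ?Z / 4) powr (1 / 3) * (2 * ?Z) powr (2 / 3) =
          (27 * ?Z / 4) powr (1 / 3) * ((2 * ?Z) powr 2) powr (1 / 3)"
      by (simp add: powr_powr)
    also have "\<dots> = (27 * ?Z / 4 * (2 * ?Z)\<^sup>2) powr (1 / 3)"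
      using zeta_3_pos by (subst powr_mult[symmetric]) (auto simp: powr_numeral)
    also have "27 * ?Z / 4 * (2 * ?Z)\<^sup>2 = (3 * ?Z) powr 3"
      using zeta_3_pos by (simp add: powr_numeral power2_eq_square power3_eq_cube)
    also have "((3 * ?Z) powr 3) powr (1 / 3) = 3 * ?Z"
      using zeta_3_pos by (simp only: powr_powr) simp
    finally have c: "(27 * ?Z / 4) powr (1 / 3) * (2 * ?Z) powr (2 / 3) = 3 * ?Z" .
    have "0 < (27 * ?Z / 4) powr (1 / 3)" "0 < (2 * ?Z) powr (2 / 3)" "0 < real n powr (2 / 3)"
      using zeta_3_pos elim by simp_all
    thus ?case unfolding u2 c[symmetric] by (simp add: field_simps)
  qed
  ultimately show "(\<lambda>n. ln (real (PL n)) / ((27 * ?Z / 4) powr (1 / 3) * real n powr (2 / 3))) \<longlonglongrightarrow> 1"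
    by (rule Lim_transform_eventually)
qed

end
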